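(* Let $n\ge 1$, $N\in\mathbb{N}$, $S>0$, and let $\phi_\lambda:\mathbb{D}^n(S)\to\mathbb{C}$ be an analytic function over $\mathbb{D}^n(S)$ with Taylor expansion $\phi_\lambda(x)=\sum_{k\in\mathbb{N}_0^n}c_k x^k$. Assume that its Taylor coefficients satisfy $$\sum_{|k|>N}|c_k|^2S^{2|k|}<M_2(N)$$ for some $M_2(N)\in\mathbb{R}^+$. Then, for every $R$ with $0<R<S$ and every $x\in\mathbb{D}^n(R)$, $$|\phi_\lambda(x)-(P_N\phi_\lambda)(x)|<\sqrt{M_2(N)}\,\sqrt{\left(\frac{1}{1-(R/S)^2}\right)^n-\sum_{k=0}^{N}\binom{n+k-1}{k}\left(\frac{R}{S}\right)^{2k}}.$$
   Context: For $r>0$, $\mathbb{D}^n(r)=\{x\in\mathbb{R}^n : |x_i|<r \text{ for all } i\}$. For a multi-index $k=(k_1,\dots,k_n)\in\mathbb{N}_0^n$ (where $\mathbb{N}_0=\{0,1,2,\dots\}$ here), $|k|=k_1+\cdots+k_n$ and $x^k=x_1^{k_1}\cdots x_n^{k_n}$. "Analytic over $\mathbb{D}^n(S)$" means that the function is equal on $\mathbb{D}^n(S)$ to the sum of its (convergent) Taylor series at the origin, with coefficients $c_k\in\mathbb{C}$. $P_N$ is the truncation operator of the Taylor series at total degree $N$: $(P_N\phi_\lambda)(x)=\sum_{|k|\le N}c_kx^k$. (In the paper $\phi_\lambda$ is an eigenfunction of a Koopman generator, but the paper states that the result holds for any analytic function.) *)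

theory Defs
  imports "HOL-Analysis.Analysis"
begin

text \<open>
  The dimension \<open>n\<close> is \<open>CARD('n)\<close>, and a multi-index is a function \<open>k :: 'n \<Rightarrow> nat\<close>.
\<close>

definition polydisc :: "real \<Rightarrow> (real ^ 'n::finite) set" where
  "polydisc r = {x. \<forall>i. \<bar>x $ i\<bar> < r}"

definition total_degree :: "('n::finite \<Rightarrow> nat) \<Rightarrow> nat" where
  "total_degree k = (\<Sum>i\<in>UNIV. k i)"

definition monomial :: "('n::finite \<Rightarrow> nat) \<Rightarrow> real ^ 'n \<Rightarrow> real" where
  "monomial k x = (\<Prod>i\<in>UNIV. (x $ i) ^ k i)"

definition partial_derivative ::
    "'n::finite \<Rightarrow> (real ^ 'n \<Rightarrow> complex) \<Rightarrow> real ^ 'n \<Rightarrow> complex" where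
  "partial_derivative i f x = vector_derivative (\<lambda>t. f (x + t *\<^sub>R axis i 1)) (at 0)"

text \<open>
  As the index type carries no order, the order of differentiation is left to a choice operator:
  any list containing each \<open>i\<close> exactly \<open>k i\<close> times will do. For functions that are smooth near the
  evaluation point the result does not depend on the list, by symmetry of partial derivatives.
\<close>

definition multi_derivative ::
    "('n::finite \<Rightarrow> nat) \<Rightarrow> (real ^ 'n \<Rightarrow> complex) \<Rightarrow> real ^ 'n \<Rightarrow> complex" where
  "multi_derivative k f = foldr partial_derivative (SOME is. \<forall>i. count_list is i = k i) f"

definition taylor_coeff :: "(real ^ 'n::finite \<Rightarrow> complex) \<Rightarrow> ('n \<Rightarrow> nat) \<Rightarrow> complex" where
  "taylor_coeff f k = multi_derivative k f 0 / of_nat (\<Prod>i\<in>UNIV. fact (k i))"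

text \<open>
  Differentiability at the origin need not be demanded separately: a function that is the sum of
  a power series on a polydisc around the origin is smooth there. Values of \<open>f\<close> outside the
  polydisc are irrelevant, since \<open>taylor_coeff\<close> depends only on the germ of \<open>f\<close> at the origin.
\<close>

definition analytic_over_polydisc :: "(real ^ 'n::finite \<Rightarrow> complex) \<Rightarrow> real \<Rightarrow> bool" where
  "analytic_over_polydisc f r \<longleftrightarrow>
     (\<forall>x\<in>polydisc r. ((\<lambda>k. taylor_coeff f k * of_real (monomial k x)) has_sum f x) UNIV)"

definition taylor_truncation ::
    "nat \<Rightarrow> (real ^ 'n::finite \<Rightarrow> complex) \<Rightarrow> real ^ 'n \<Rightarrow> complex" where
  "taylor_truncation N f x =
     (\<Sum>k | total_degree k \<le> N. taylor_coeff f k * of_real (monomial k x))"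

end

theory Submission
  imports Defs
begin

text \<open>
  The remainder is the sum of \<open>c\<^sub>k x\<^sup>k\<close> over \<open>|k| > N\<close>. Splitting each term as
  \<open>c\<^sub>k S\<^bsup>|k|\<^esup> \<cdot> x\<^sup>k / S\<^bsup>|k|\<^esup>\<close> and bounding the second factor by \<open>(R/S)\<^bsup>|k|\<^esup>\<close>, Cauchy-Schwarz
  reduces the claim to the tail of \<open>\<Sum>\<^sub>k q\<^bsup>|k|\<^esup>\<close> with \<open>q = (R/S)\<^sup>2\<close>. The full sum is the \<open>n\<close>-th power of
  a geometric series, and there are \<open>n + m - 1\<close> choose \<open>m\<close> multi-indices of degree \<open>m\<close>.
\<close>

text \<open>The finite Cauchy-Schwarz inequality bounds every finite partial sum by the same
  constant, and the bound passes to the limit \<open>s\<close>.\<close>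

lemma norm_has_sum_le_Cauchy_Schwarz:
  fixes f :: "'a \<Rightarrow> 'b::real_normed_vector" and a b :: "'a \<Rightarrow> real"
  assumes f: "(f has_sum s) A"
    and a: "(\<lambda>k. (a k)\<^sup>2) summable_on A" and b: "(\<lambda>k. (b k)\<^sup>2) summable_on A"
    and le: "\<And>k. k \<in> A \<Longrightarrow> norm (f k) \<le> a k * b k"
  shows "norm s \<le> sqrt (\<Sum>\<^sub>\<infinity>k\<in>A. (a k)\<^sup>2) * sqrt (\<Sum>\<^sub>\<infinity>k\<in>A. (b k)\<^sup>2)"
proof (rule tendsto_upperbound)
  show "((\<lambda>F. norm (sum f F)) \<longlongrightarrow> norm s) (finite_subsets_at_top A)"
    using f unfolding has_sum_def by (rule tendsto_norm)
  show "\<forall>\<^sub>F F in finite_subsets_at_top A.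
      norm (sum f F) \<le> sqrt (\<Sum>\<^sub>\<infinity>k\<in>A. (a k)\<^sup>2) * sqrt (\<Sum>\<^sub>\<infinity>k\<in>A. (b k)\<^sup>2)"
  proof (rule eventually_finite_subsets_at_top_weakI)
    fix F assume F: "finite F" "F \<subseteq> A"
    have "norm (sum f F) \<le> (\<Sum>k\<in>F. norm (f k))"
      by (rule norm_sum)
    \<comment> \<open>\<open>L2_set_mult_ineq\<close> speaks of absolute values, and only the
      product \<open>a k * b k\<close> is known to be nonnegative.\<close>
    also have "\<dots> \<le> (\<Sum>k\<in>F. \<bar>a k\<bar> * \<bar>b k\<bar>)"
    proof (rule sum_mono)
      fix k assume "k \<in> F"
      then have "norm (f k) \<le> a k * b k"
        using F le by blast
      also have "\<dots> \<le> \<bar>a k\<bar> * \<bar>b k\<bar>"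
        by (metis abs_ge_self abs_mult)
      finally show "norm (f k) \<le> \<bar>a k\<bar> * \<bar>b k\<bar>" .
    qed
    also have "\<dots> \<le> L2_set a F * L2_set b F"
      by (rule L2_set_mult_ineq)
    \<comment> \<open>Summability enters here: \<open>infsum\<close> of an unsummable family is 0
      and would not dominate its finite partial sums.\<close>
    also have "\<dots> \<le> sqrt (\<Sum>\<^sub>\<infinity>k\<in>A. (a k)\<^sup>2) * sqrt (\<Sum>\<^sub>\<infinity>k\<in>A. (b k)\<^sup>2)"
      unfolding L2_set_def using F a b
      by (intro mult_mono real_sqrt_le_mono finite_sum_le_infsum) (auto intro: sum_nonneg infsum_nonneg)
    finally show "norm (sum f F) \<le> sqrt (\<Sum>\<^sub>\<infinity>k\<in>A. (a k)\<^sup>2) * sqrt (\<Sum>\<^sub>\<infinity>k\<in>A. (b k)\<^sup>2)" .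
  qed
qed simp

text \<open>The term factors over the coordinates as the product of the \<open>q ^ k i\<close>, so
  the sum over all functions is a product of \<open>CARD('n)\<close> equal geometric series.\<close>

lemma has_sum_power_total_degree:
  fixes q :: real
  assumes "\<bar>q\<bar> < 1"
  shows "((\<lambda>k::'n::finite \<Rightarrow> nat. q ^ total_degree k) has_sum (1 / (1 - q)) ^ CARD('n)) UNIV"
proof -
  have geom: "((\<lambda>m. q ^ m) has_sum 1 / (1 - q)) UNIV"
    using assms by (intro norm_summable_imp_has_sum geometric_sums)
      (simp_all add: power_abs summable_geometric)
  have "(\<lambda>m. norm (q ^ m)) summable_on UNIV"
    using assms by (simp add: power_abs summable_on_UNIV_nonneg_real_iff)
  then have "(\<Sum>\<^sub>\<infinity>k\<in>PiE (UNIV::'n set) (\<lambda>_. UNIV). \<Prod>i\<in>UNIV. q ^ k i) = (1 / (1 - q)) ^ CARD('n)"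
    by (subst infsum_prod_PiE_abs) (simp_all add: infsumI[OF geom])
  then have sum: "(\<Sum>\<^sub>\<infinity>k::'n \<Rightarrow> nat. q ^ total_degree k) = (1 / (1 - q)) ^ CARD('n)"
    by (simp add: PiE_UNIV_domain total_degree_def power_sum)
  \<comment> \<open>An unsummable family has \<open>infsum\<close> value 0, so a nonzero value yields summability.\<close>
  moreover have "(1 / (1 - q)) ^ CARD('n) \<noteq> 0"
    using assms by simp
  ultimately have "(\<lambda>k::'n \<Rightarrow> nat. q ^ total_degree k) summable_on UNIV"
    by (metis infsum_not_exists)
  then show ?thesis
    using sum by (simp add: has_sum_iff)
qed

lemma finite_total_degree_le: "finite {k::'n::finite \<Rightarrow> nat. total_degree k \<le> N}"
proof (rule finite_subset)
  have "k i \<le> total_degree k" for k :: "'n \<Rightarrow> nat" and i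
    unfolding total_degree_def by (rule member_le_sum) auto
  then show "{k::'n \<Rightarrow> nat. total_degree k \<le> N} \<subseteq> PiE UNIV (\<lambda>_. {..N})"
    by (auto simp: PiE_UNIV_domain intro: order_trans)
qed (simp add: finite_PiE)

text \<open>Stars and bars is available for lists with prescribed length and sum. An enumeration
  \<open>h\<close> of the coordinates, with inverse \<open>g\<close>, carries the count over to
  functions.\<close>

lemma card_total_degree_eq:
  "card {k::'n::finite \<Rightarrow> nat. total_degree k = m} = (CARD('n) + m - 1) choose m"
proof -
  obtain h :: "nat \<Rightarrow> 'n" where h: "bij_betw h {0..<CARD('n)} UNIV"
    using ex_bij_betw_nat_finite[OF finite] by blast
  define g where "g = inv_into {0..<CARD('n)} h"
  have g: "g i < CARD('n)" "h (g i) = i" for i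
    using bij_betw_inv_into_right[OF h, of i] bij_betwE[OF bij_betw_inv_into[OF h]]
    by (auto simp: g_def)
  have gh: "g (h j) = j" if "j < CARD('n)" for j
    using bij_betw_inv_into_left[OF h, of j] that by (simp add: g_def)
  have deg: "total_degree k = sum_list (map (k \<circ> h) [0..<CARD('n)])" for k :: "'n \<Rightarrow> nat"
    using sum.reindex_bij_betw[OF h, of k]
    by (simp add: total_degree_def sum_list_distinct_conv_sum_set)
  have "bij_betw (\<lambda>k. map (k \<circ> h) [0..<CARD('n)]) {k. total_degree k = m}
          {l. length l = CARD('n) \<and> sum_list l = m}"
  \<comment> \<open>The inverse map reads the value at \<open>i\<close> from position
    \<open>g i\<close> of the list.\<close>
  proof (rule bij_betw_byWitness[where f' = "\<lambda>l i. l ! g i"])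
    have *: "map ((\<lambda>i. l ! g i) \<circ> h) [0..<CARD('n)] = l" if "length l = CARD('n)" for l :: "nat list"
      using that by (intro nth_equalityI) (auto simp: gh)
    then show "\<forall>l\<in>{l. length l = CARD('n) \<and> sum_list l = m}. map ((\<lambda>i. l ! g i) \<circ> h) [0..<CARD('n)] = l"
      by blast
    show "(\<lambda>l i. l ! g i) ` {l. length l = CARD('n) \<and> sum_list l = m} \<subseteq> {k. total_degree k = m}"
      using * by (auto simp del: map_map simp: deg)
  qed (auto simp: deg g)
  then show ?thesis
    using card_length_sum_list[of "CARD('n)" m] by (simp add: bij_betw_same_card add.commute)
qed

lemma sum_power_total_degree_le:
  fixes q :: real
  shows "(\<Sum>k::'n::finite \<Rightarrow> nat | total_degree k \<le> N. q ^ total_degree k) =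
    (\<Sum>m=0..N. real ((CARD('n) + m - 1) choose m) * q ^ m)"
proof -
  have "(\<Sum>k::'n \<Rightarrow> nat | total_degree k \<le> N. q ^ total_degree k) =
      (\<Sum>m=0..N. \<Sum>k | k \<in> {k::'n \<Rightarrow> nat. total_degree k \<le> N} \<and> total_degree k = m. q ^ total_degree k)"
    by (rule sum.group[symmetric]) (auto simp: finite_total_degree_le)
  also have "\<dots> = (\<Sum>m=0..N. real (card {k::'n \<Rightarrow> nat. total_degree k = m}) * q ^ m)"
  proof (rule sum.cong)
    fix m assume "m \<in> {0..N}"
    then have "{k. k \<in> {k::'n \<Rightarrow> nat. total_degree k \<le> N} \<and> total_degree k = m} = {k. total_degree k = m}"
      by auto
    then show "(\<Sum>k | k \<in> {k::'n \<Rightarrow> nat. total_degree k \<le> N} \<and> total_degree k = m. q ^ total_degree k) =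
        real (card {k::'n \<Rightarrow> nat. total_degree k = m}) * q ^ m"
      by simp
  qed simp
  finally show ?thesis
    by (simp add: card_total_degree_eq)
qed

text \<open>Deleting the finitely many terms of degree at most \<open>N\<close> from the full sum
  leaves the tail. For q = (R/S)^2 it is the radicand of the claimed bound.\<close>

lemma has_sum_power_total_degree_gt:
  fixes q :: real
  assumes "\<bar>q\<bar> < 1"
  shows "((\<lambda>k. q ^ total_degree k) has_sum (1 / (1 - q)) ^ CARD('n) -
    (\<Sum>m=0..N. real ((CARD('n) + m - 1) choose m) * q ^ m)) {k::'n::finite \<Rightarrow> nat. total_degree k > N}"
proof -
  have "((\<lambda>k. q ^ total_degree k) has_sum (1 / (1 - q)) ^ CARD('n) -
    (\<Sum>m=0..N. real ((CARD('n) + m - 1) choose m) * q ^ m)) (UNIV - {k::'n \<Rightarrow> nat. total_degree k \<le> N})"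
    using has_sum_power_total_degree[OF assms, where 'n = 'n]
    by (rule has_sum_Diff)
      (simp_all add: finite_total_degree_le has_sum_finiteI sum_power_total_degree_le)
  also have "UNIV - {k::'n \<Rightarrow> nat. total_degree k \<le> N} = {k. total_degree k > N}"
    by auto
  finally show ?thesis .
qed

text \<open>The inequality is weak because both sides equal 1 for the zero multi-index.\<close>

lemma abs_monomial_le:
  assumes "x \<in> polydisc R"
  shows "\<bar>monomial k x\<bar> \<le> R ^ total_degree k"
proof -
  have "\<bar>monomial k x\<bar> = (\<Prod>i\<in>UNIV. \<bar>x $ i\<bar> ^ k i)"
    by (simp add: monomial_def abs_prod power_abs)
  also have "\<dots> \<le> (\<Prod>i\<in>UNIV. R ^ k i)"
    using assms by (intro prod_mono conjI power_mono) (auto simp: polydisc_def less_imp_le)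
  finally show ?thesis
    by (simp add: total_degree_def power_sum)
qed

theorem proposition3:
  fixes \<phi> :: "real ^ 'n::finite \<Rightarrow> complex"
    and N :: nat and S M R :: real and x :: "real ^ 'n"
  assumes "S > 0"
    and "analytic_over_polydisc \<phi> S"
    and "M > 0"
    and "(\<lambda>k. (cmod (taylor_coeff \<phi> k))\<^sup>2 * S ^ (2 * total_degree k))
           summable_on {k. total_degree k > N}"
    and "(\<Sum>\<^sub>\<infinity>k\<in>{k. total_degree k > N}.
            (cmod (taylor_coeff \<phi> k))\<^sup>2 * S ^ (2 * total_degree k)) < M"
    and "0 < R" and "R < S"
    and "x \<in> polydisc R"
  shows "cmod (\<phi> x - taylor_truncation N \<phi> x) <
         sqrt M * sqrt ((1 / (1 - (R / S)\<^sup>2)) ^ CARD('n)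
           - (\<Sum>k=0..N. real ((CARD('n) + k - 1) choose k) * (R / S) ^ (2 * k)))"
proof -
  let ?I = "{k::'n \<Rightarrow> nat. total_degree k > N}"
  define c where "c = taylor_coeff \<phi>"
  define q where "q = (R / S)\<^sup>2"
  define T where "T = (1 / (1 - q)) ^ CARD('n) - (\<Sum>k=0..N. real ((CARD('n) + k - 1) choose k) * q ^ k)"
  \<comment> \<open>The powers of \<open>S\<close> cancel in \<open>a k * b k\<close>, leaving
    \<open>cmod (c k) * R ^ total_degree k\<close>, which dominates the Taylor term at
    \<open>x\<close>.\<close>
  define a where "a k = cmod (c k) * S ^ total_degree k" for k
  define b where "b k = (R / S) ^ total_degree k" for k :: "'n \<Rightarrow> nat"
  have q: "0 < q" "\<bar>q\<bar> < 1"
    using \<open>0 < R\<close> \<open>R < S\<close> by (simp_all add: q_def power_less_one_iff abs_square_less_1)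
  have asq: "(a k)\<^sup>2 = (cmod (c k))\<^sup>2 * S ^ (2 * total_degree k)" for k
    by (simp add: a_def power_mult_distrib flip: power_mult) (simp add: mult.commute)
  have bsq: "(b k)\<^sup>2 = q ^ total_degree k" for k
    by (simp add: b_def q_def mult.commute flip: power_mult)
  have b: "((\<lambda>k. (b k)\<^sup>2) has_sum T) ?I"
    unfolding bsq T_def using q(2) by (rule has_sum_power_total_degree_gt)
  \<comment> \<open>Cauchy-Schwarz gives only a weak inequality. The final strictness comes from the
    strict bound by \<open>M\<close>, which survives multiplication by \<open>sqrt T\<close> only if
    \<open>T\<close> is positive.\<close>
  have "T > 0"
  proof -
    \<comment> \<open>One positive term of the tail suffices: the constant multi-index
      \<open>Suc N\<close> has degree \<open>Suc N * CARD('n)\<close>, which exceeds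
      \<open>N\<close>.\<close>
    define k0 where "k0 = (\<lambda>_::'n. Suc N)"
    have "Suc N * 1 \<le> Suc N * CARD('n)"
      by (intro mult_le_mono2) (simp add: Suc_leI)
    then have "k0 \<in> ?I"
      by (simp add: k0_def total_degree_def mult.commute Suc_le_eq)
    then have "(b k0)\<^sup>2 \<le> T"
      using finite_sum_le_has_sum[OF b, of "{k0}"] by simp
    moreover have "(b k0)\<^sup>2 > 0"
      using q by (simp add: bsq)
    ultimately show ?thesis
      by (rule less_le_trans[rotated])
  qed
  have "x \<in> polydisc S"
    using \<open>x \<in> polydisc R\<close> \<open>R < S\<close> by (auto simp: polydisc_def intro: less_trans)
  then have "((\<lambda>k. c k * of_real (monomial k x)) has_sum \<phi> x) UNIV"
    using \<open>analytic_over_polydisc \<phi> S\<close> by (simp add: analytic_over_polydisc_def c_def)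
  \<comment> \<open>The truncation is the finite low-degree part of the series, so removing it
    leaves the remainder as a sum over the tail.\<close>
  then have "((\<lambda>k. c k * of_real (monomial k x)) has_sum \<phi> x - taylor_truncation N \<phi> x)
      (UNIV - {k. total_degree k \<le> N})"
    by (rule has_sum_Diff)
      (simp_all add: finite_total_degree_le has_sum_finiteI taylor_truncation_def c_def)
  moreover have "UNIV - {k::'n \<Rightarrow> nat. total_degree k \<le> N} = ?I"
    by auto
  ultimately have remainder:
      "((\<lambda>k. c k * of_real (monomial k x)) has_sum \<phi> x - taylor_truncation N \<phi> x) ?I"
    by simp
  have "cmod (\<phi> x - taylor_truncation N \<phi> x)
      \<le> sqrt (\<Sum>\<^sub>\<infinity>k\<in>?I. (a k)\<^sup>2) * sqrt (\<Sum>\<^sub>\<infinity>k\<in>?I. (b k)\<^sup>2)"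
  proof (rule norm_has_sum_le_Cauchy_Schwarz[OF remainder])
    show "(\<lambda>k. (a k)\<^sup>2) summable_on ?I"
      using assms(4) by (simp add: asq c_def)
    show "(\<lambda>k. (b k)\<^sup>2) summable_on ?I"
      using b by (rule has_sum_imp_summable)
    show "cmod (c k * of_real (monomial k x)) \<le> a k * b k" for k
    proof -
      have "a k * b k = cmod (c k) * R ^ total_degree k"
        using \<open>S > 0\<close> by (simp add: a_def b_def power_divide)
      then show ?thesis
        using abs_monomial_le[OF \<open>x \<in> polydisc R\<close>, of k] by (simp add: norm_mult mult_left_mono)
    qed
  qed
  also have "\<dots> < sqrt M * sqrt T"
    using assms(5) \<open>T > 0\<close> by (simp add: infsumI[OF b] asq c_def)
  finally show ?thesis
    by (simp add: T_def q_def flip: power_mult)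
qed

end
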